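(* For every $n\ge 3$, the Betti numbers $b_{n,i}=\dim H^{2i}(\overline{\mathcal M}_{0,n};\mathbb Q)$, $0\le i\le n-3$, form an ultra-log-concave sequence: $$\left(\frac{b_{n,i}}{\binom{n-3}{i}}\right)^2\geq \frac{b_{n,i-1}}{\binom{n-3}{i-1}}\cdot\frac{b_{n,i+1}}{\binom{n-3}{i+1}}\qquad\text{for all } 1\le i\le n-4.$$
   Context: $\overline{\mathcal M}_{0,n}$ ($n\ge 3$) is the Deligne--Mumford moduli space of stable $n$-pointed rational curves (over $\mathbb C$), a smooth irreducible projective variety of dimension $n-3$ with vanishing odd cohomology. Write $P_n(t)=\sum_{i=0}^{n-3} b_{n,i}t^i$. With the convention $P_1(t)=P_2(t)=P_3(t)=1$, the polynomials $P_n(t)$ are computed by the standard (Keel--Manin--Getzler) recurrence, valid for $n>3$: $$P_n(t)=(1+t)P_{n-1}(t)+t\sum_{j=3}^{n-2}\binom{n-2}{j-1}P_j(t)P_{n+1-j}(t),$$ where an empty sum is zero. *)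

theory Defs
  imports "HOL-Analysis.Urysohn" "HOL-Homology.Homology"
    "HOL-Computational_Algebra.Polynomial"
begin

section \<open>The complex projective line\<close>

text \<open>
  The complex projective line is \<^typ>\<open>complex option\<close>: \<^term>\<open>Some z\<close> is the point [z : 1] and
  \<^term>\<open>None\<close> is the point at infinity [1 : 0].
\<close>

type_synonym cp1 = "complex option"

definition cp1_topology :: "cp1 topology" where
  "cp1_topology = Alexandroff_compactification euclidean"

fun moebius_map :: "complex \<Rightarrow> complex \<Rightarrow> complex \<Rightarrow> complex \<Rightarrow> cp1 \<Rightarrow> cp1" where
  "moebius_map a b c d (Some z) =
     (if c * z + d = 0 then None else Some ((a * z + b) / (c * z + d)))"
| "moebius_map a b c d None = (if c = 0 then None else Some (a / c))"

definition cp1_automorphisms :: "(cp1 \<Rightarrow> cp1) set" where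
  "cp1_automorphisms = {moebius_map a b c d | a b c d. a * d - b * c \<noteq> 0}"

text \<open>The determinant of the homogeneous coordinate vectors of two points.\<close>

fun cp1_det :: "cp1 \<Rightarrow> cp1 \<Rightarrow> complex" where
  "cp1_det (Some z) (Some w) = z - w"
| "cp1_det (Some z) None = - 1"
| "cp1_det None (Some w) = 1"
| "cp1_det None None = 0"

text \<open>
  For finite points this is ((p - r)(q - s)) / ((p - s)(q - r)). If at least three of the four points
  are different, numerator and denominator do not both vanish, so this is the correct point of
  the projective line.
\<close>

definition cp1_cross_ratio :: "cp1 \<Rightarrow> cp1 \<Rightarrow> cp1 \<Rightarrow> cp1 \<Rightarrow> cp1" where
  "cp1_cross_ratio p q r s =
     (let num = cp1_det p r * cp1_det q s; den = cp1_det p s * cp1_det q r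
      in if den = 0 then None else Some (num / den))"


section \<open>Stable pointed rational curves\<close>

text \<open>
  A connected nodal curve of arithmetic genus 0 is a finite tree of projective lines. It is recorded
  by its dual tree (\<open>verts\<close>, with a symmetric relation \<open>edges\<close>), by the point \<open>node C a b\<close> of the
  component \<open>a\<close> at which it is glued to an adjacent component \<open>b\<close>, and by the component and the point
  on it that carry the \<open>i\<close>-th marking, for \<open>1 \<le> i \<le> n\<close>. The values of \<open>node\<close> outside
  \<open>edges\<close> and of \<open>mark_vert\<close>, \<open>mark_pt\<close> outside \<open>{1..n}\<close> are irrelevant, and the
  isomorphism relation ignores them.
\<close>

record curve =
  verts :: "nat set"
  edges :: "(nat \<times> nat) set"
  node :: "nat \<Rightarrow> nat \<Rightarrow> cp1"
  mark_vert :: "nat \<Rightarrow> nat"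
  mark_pt :: "nat \<Rightarrow> cp1"

text \<open>In a tree every edge is a bridge; this is the last condition.\<close>

definition is_tree :: "nat set \<Rightarrow> (nat \<times> nat) set \<Rightarrow> bool" where
  "is_tree V E \<longleftrightarrow>
     finite V \<and> V \<noteq> {} \<and> E \<subseteq> V \<times> V \<and> sym E \<and> irrefl E \<and>
     (\<forall>a\<in>V. \<forall>b\<in>V. (a, b) \<in> E\<^sup>*) \<and>
     (\<forall>a b. (a, b) \<in> E \<longrightarrow> (a, b) \<notin> (E - {(a, b), (b, a)})\<^sup>*)"

definition special :: "nat \<Rightarrow> curve \<Rightarrow> nat \<Rightarrow> (nat + nat) set" where
  "special n C a =
     Inl ` {b. (a, b) \<in> edges C} \<union> Inr ` {i \<in> {1..n}. mark_vert C i = a}"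

definition special_pt :: "curve \<Rightarrow> nat \<Rightarrow> nat + nat \<Rightarrow> cp1" where
  "special_pt C a = case_sum (node C a) (mark_pt C)"

definition stable_curves :: "nat \<Rightarrow> curve set" where
  "stable_curves n =
     {C. is_tree (verts C) (edges C) \<and>
         (\<forall>i\<in>{1..n}. mark_vert C i \<in> verts C) \<and>
         (\<forall>a\<in>verts C. inj_on (special_pt C a) (special n C a) \<and> card (special n C a) \<ge> 3)}"

definition curve_iso :: "nat \<Rightarrow> curve \<Rightarrow> curve \<Rightarrow> bool" where
  "curve_iso n C D \<longleftrightarrow>
     (\<exists>f \<phi>. bij_betw f (verts C) (verts D) \<and>
        (\<forall>a\<in>verts C. \<forall>b\<in>verts C. (a, b) \<in> edges C \<longleftrightarrow> (f a, f b) \<in> edges D) \<and>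
        (\<forall>a\<in>verts C. \<phi> a \<in> cp1_automorphisms) \<and>
        (\<forall>a b. (a, b) \<in> edges C \<longrightarrow> \<phi> a (node C a b) = node D (f a) (f b)) \<and>
        (\<forall>i\<in>{1..n}. mark_vert D i = f (mark_vert C i) \<and>
                    mark_pt D i = \<phi> (mark_vert C i) (mark_pt C i)))"

definition curve_iso_rel :: "nat \<Rightarrow> (curve \<times> curve) set" where
  "curve_iso_rel n =
     {(C, D). C \<in> stable_curves n \<and> D \<in> stable_curves n \<and> curve_iso n C D}"


section \<open>The moduli space\<close>

text \<open>
  The image of the \<open>i\<close>-th marking when the curve is contracted to its component \<open>a\<close>: either the
  marked point itself or the node of \<open>a\<close> towards the component that carries the marking.
\<close>

definition mark_image :: "curve \<Rightarrow> nat \<Rightarrow> nat \<Rightarrow> cp1" where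
  "mark_image C a i =
     (if mark_vert C i = a then mark_pt C i
      else node C a (THE b. (a, b) \<in> edges C \<and>
                            (b, mark_vert C i) \<in> (Restr (edges C) (- {a}))\<^sup>*))"

text \<open>
  The image of \<open>C\<close> under the morphism to \<open>cp1\<close> = (stable curves with markings \<open>i, j, k, l\<close>)
  that forgets the other markings. On some component at least three of the four markings have
  different images, and the cross-ratio does not depend on the choice of such a component.
\<close>

definition curve_cross_ratio :: "curve \<Rightarrow> nat \<times> nat \<times> nat \<times> nat \<Rightarrow> cp1" where
  "curve_cross_ratio C = (\<lambda>(i, j, k, l).
     THE w. \<exists>a\<in>verts C. card (mark_image C a ` {i, j, k, l}) \<ge> 3 \<and>
       w = cp1_cross_ratio (mark_image C a i) (mark_image C a j)
                           (mark_image C a k) (mark_image C a l))"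

definition quadruples :: "nat \<Rightarrow> (nat \<times> nat \<times> nat \<times> nat) set" where
  "quadruples n = {(i, j, k, l). {i, j, k, l} \<subseteq> {1..n} \<and> distinct [i, j, k, l]}"

text \<open>
  The space of complex points, with the classical topology, of the moduli space of stable
  \<open>n\<close>-pointed rational curves. Its points are the isomorphism classes of stable curves. The
  forgetful maps to the 4-pointed moduli spaces, which are the cross-ratios, together form a
  closed embedding of the moduli space into a product of projective lines (Gerritzen, Herrlich
  and van der Put; McDuff and Salamon, \<open>J-holomorphic Curves and Symplectic Topology\<close>,
  Appendix D), so the classical topology is the initial topology of the cross-ratios. For \<open>n = 3\<close>
  there are no cross-ratios and the space is a point.
\<close>

definition moduli_space :: "nat \<Rightarrow> curve set topology" where
  "moduli_space n =
     pullback_topology (stable_curves n // curve_iso_rel n)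
       (\<lambda>X. \<lambda>q\<in>quadruples n. curve_cross_ratio (SOME C. C \<in> X) q)
       (product_topology (\<lambda>q. cp1_topology) (quadruples n))"


section \<open>Rational singular cohomology\<close>

text \<open>
  The library has singular homology with integer coefficients only. Singular cohomology with
  rational coefficients is built here on its singular simplices. A cochain is a rational function
  on the singular simplices, extended by 0.
\<close>

definition cochains :: "nat \<Rightarrow> 'a topology \<Rightarrow> (((nat \<Rightarrow> real) \<Rightarrow> 'a) \<Rightarrow> rat) set" where
  "cochains p X = {c. \<forall>s. \<not> singular_simplex p X s \<longrightarrow> c s = 0}"

definition coboundary ::
  "nat \<Rightarrow> 'a topology \<Rightarrow> (((nat \<Rightarrow> real) \<Rightarrow> 'a) \<Rightarrow> rat) \<Rightarrow> ((nat \<Rightarrow> real) \<Rightarrow> 'a) \<Rightarrow> rat" where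
  "coboundary p X c =
     (\<lambda>s. if singular_simplex (Suc p) X s
          then \<Sum>k\<le>Suc p. (- 1) ^ k * c (singular_face (Suc p) k s) else 0)"

definition cocycles :: "nat \<Rightarrow> 'a topology \<Rightarrow> (((nat \<Rightarrow> real) \<Rightarrow> 'a) \<Rightarrow> rat) set" where
  "cocycles p X = {c \<in> cochains p X. coboundary p X c = (\<lambda>s. 0)}"

definition coboundaries :: "nat \<Rightarrow> 'a topology \<Rightarrow> (((nat \<Rightarrow> real) \<Rightarrow> 'a) \<Rightarrow> rat) set" where
  "coboundaries p X =
     (case p of 0 \<Rightarrow> {\<lambda>s. 0} | Suc q \<Rightarrow> coboundary q X ` cochains q X)"

text \<open>
  The dimension of the quotient of a rational vector space \<open>Z\<close> of functions by a subspace \<open>B\<close>, if it is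
  finite: it is \<open>d\<close> if the classes of some \<open>e 0, \<dots>, e (d - 1)\<close> form a basis of \<open>Z / B\<close>.
\<close>

definition quotient_dim :: "('x \<Rightarrow> rat) set \<Rightarrow> ('x \<Rightarrow> rat) set \<Rightarrow> nat" where
  "quotient_dim Z B =
     (THE d. \<exists>e :: nat \<Rightarrow> 'x \<Rightarrow> rat. (\<forall>j<d. e j \<in> Z) \<and>
        (\<forall>z\<in>Z. \<exists>!a. a \<in> extensional {..<d} \<and> (\<lambda>x. z x - (\<Sum>j<d. a j * e j x)) \<in> B))"

definition cohomology_dim :: "nat \<Rightarrow> 'a topology \<Rightarrow> nat" where
  "cohomology_dim p X = quotient_dim (cocycles p X) (coboundaries p X)"


section \<open>Betti numbers and Poincare polynomials\<close>

definition betti :: "nat \<Rightarrow> nat \<Rightarrow> nat" where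
  "betti n i = cohomology_dim (2 * i) (moduli_space n)"

text \<open>
  The value 1 for \<open>n < 3\<close> is a convention; for \<open>n = 3\<close> the sum is \<open>betti 3 0\<close>.
\<close>

definition poincare_poly :: "nat \<Rightarrow> real poly" where
  "poincare_poly n =
     (if n < 3 then 1 else \<Sum>i\<le>n - 3. monom (of_nat (betti n i)) i)"

end

(* For fixed t, the recurrence says that phi = sum P_(n+1)(t) x^n / n! satisfies
   (1 + t (x - phi)) phi' = 1 + phi. Put u = 1 + phi, y = phi' and z = y - 1. Differentiating gives
   u y' = y^2 (1 + t z), so phi^(k+2) u^(k+1) = y^(k+2) (1 + t z) L_k(z) for polynomials L_k (keel_flow k t)
   whose recurrence is linear, and P_(k+3)(t) = L_k(0). For t < 0, Rolle's theorem shows that L_k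
   has k simple roots in (-1, -1/t). They are all positive for t near 0 and all negative for t near
   -infinity. Being simple, they move continuously and cross 0 at k different values of t. So P_(k+3)
   has k negative roots, and Newton's inequalities apply. *)

theory Submission
  imports Defs "HOL-Computational_Algebra.Polynomial_FPS"
begin

text \<open>The recurrence is quadratic and mixes all smaller polynomials, so interlacing of
  consecutive \<open>P_n\<close> is not directly accessible. The extra variable \<open>z\<close>
  repairs this: for fixed \<open>t\<close>, the step from L_k to L_(k+1) is a first-order linear
  operator to which Rolle's theorem applies. The ends -1 and -1/t of the root interval are the zeros
  of \<open>y\<close> and of \<open>1 + t z\<close>, that is, of the right-hand side of the equation
  for \<open>y'\<close>. The point \<open>z = 0\<close> is the value at \<open>x = 0\<close>. What
  is then known are roots in \<open>z\<close> for each \<open>t\<close>, whereas the claim concerns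
  roots in \<open>t\<close> of the values at \<open>z = 0\<close>. A root may cross 0 back and
  forth, so crossings are told apart by the number of positive roots at that moment, and root counts
  in open sets replace continuous root functions. The assumed recurrence starts at
  \<open>m = 4\<close>. The value at \<open>m = 3\<close> is therefore extracted from the definition
  of the moduli space, as far as the argument requires.\<close>

section \<open>Newton's inequalities\<close>

text \<open>The largest point of \<open>A\<close> is split off, so the new critical point lies to
  the right of all earlier ones and is distinct from them. The derivative is asked for only in the
  open interval because a later application has powers of \<open>1 + z\<close> and
  \<open>1 + t * z\<close> that vanish at the two ends.\<close>

lemma Rolle_finite:
  fixes f f' :: "real \<Rightarrow> real"
  assumes "finite A" "card A = Suc m" "A \<subseteq> {a..b}" "\<And>x. x \<in> A \<Longrightarrow> f x = 0"
    and "continuous_on {a..b} f"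
    and "\<And>x. a < x \<Longrightarrow> x < b \<Longrightarrow> (f has_real_derivative f' x) (at x)"
  shows "\<exists>B. finite B \<and> card B = m \<and> B \<subseteq> {Min A<..<Max A} \<and> (\<forall>x\<in>B. f' x = 0)"
  using assms(1-4)
proof (induction m arbitrary: A)
  case 0
  show ?case by (intro exI[of _ "{}"]) simp
next
  case (Suc m)
  define M where "M = Max A"
  define A' where "A' = A - {M}"
  have M: "M \<in> A" using Suc.prems unfolding M_def by (intro Max_in) auto
  have A': "finite A'" "card A' = Suc m" using Suc.prems M by (auto simp: A'_def)
  then have "A' \<noteq> {}" by auto
  then have N: "Max A' \<in> A'" using A' by simp
  obtain B where B: "finite B" "card B = m" "B \<subseteq> {Min A'<..<Max A'}" "\<forall>x\<in>B. f' x = 0"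
    using Suc.IH[OF A'] Suc.prems by (metis A'_def Diff_iff subset_iff)
  have lt: "Max A' < M"
    using N Max_ge[OF Suc.prems(1), of "Max A'"] by (fastforce simp: A'_def M_def)
  have inA: "Max A' \<in> A" using N by (simp add: A'_def)
  have ab: "a \<le> Max A'" "M \<le> b" using inA M Suc.prems(3) by auto
  have "\<exists>z. Max A' < z \<and> z < M \<and> (\<lambda>v. v * f' z) = (\<lambda>v. 0)"
  proof (rule Rolle_deriv)
    show "f (Max A') = f M" using Suc.prems(4) inA M by simp
    show "continuous_on {Max A'..M} f"
      by (rule continuous_on_subset[OF assms(5)]) (use ab in auto)
    show "(f has_derivative (\<lambda>v. v * f' x)) (at x)" if "Max A' < x" "x < M" for x
      using assms(6)[of x] that ab by (simp add: has_field_derivative_def mult_commute_abs)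
  qed (rule lt)
  then obtain z where z: "Max A' < z" "z < M" "f' z = 0" by (metis mult_1)
  have "Min A \<le> Min A'" using \<open>A' \<noteq> {}\<close> Suc.prems(1) by (intro Min_antimono) (auto simp: A'_def)
  moreover have "Min A' \<le> Max A'" using A' N by simp
  ultimately have "insert z B \<subseteq> {Min A<..<Max A}"
    using B(3) z lt by (fastforce simp: M_def[symmetric])
  moreover have "z \<notin> B" using B(3) z by auto
  ultimately show ?case using B z by (intro exI[of _ "insert z B"]) auto
qed

text \<open>The roots form a set, hence are distinct, and Rolle's theorem loses exactly one of them
  per differentiation. An upper bound on the degree suffices: with \<open>m\<close> roots it becomes
  an equality.\<close>

definition neg_rooted :: "nat \<Rightarrow> real poly \<Rightarrow> bool" where
  "neg_rooted m p \<longleftrightarrow> p \<noteq> 0 \<and> degree p \<le> m \<and> (\<exists>A. finite A \<and> card A = m \<and> (\<forall>x\<in>A. x < 0 \<and> poly p x = 0))"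

lemma neg_rooted_degree:
  assumes "neg_rooted m p"
  shows "degree p = m"
proof -
  obtain A where A: "finite A" "card A = m" "\<forall>x\<in>A. x < 0 \<and> poly p x = 0" and p: "p \<noteq> 0" "degree p \<le> m"
    using assms by (auto simp: neg_rooted_def)
  have "card A \<le> card {x. poly p x = 0}"
    using A p by (intro card_mono poly_roots_finite) auto
  then show ?thesis using card_poly_roots_bound[OF p(1)] A p by simp
qed

lemma neg_rooted_pderiv:
  assumes "neg_rooted (Suc m) p"
  shows "neg_rooted m (pderiv p)"
proof -
  obtain A where A: "finite A" "card A = Suc m" "\<forall>x\<in>A. x < 0 \<and> poly p x = 0"
    using assms by (auto simp: neg_rooted_def)
  have deg: "degree p = Suc m" by (rule neg_rooted_degree[OF assms])
  have "A \<noteq> {}" using A by auto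
  then have "Max A < 0" using A by simp
  obtain B where B: "finite B" "card B = m" "B \<subseteq> {Min A<..<Max A}" "\<forall>x\<in>B. poly (pderiv p) x = 0"
    using Rolle_finite[OF A(1,2), of "Min A" "Max A" "poly p" "poly (pderiv p)"] A
    by (force intro: poly_DERIV continuous_intros simp: subset_iff)
  then have "\<forall>x\<in>B. x < 0" using \<open>Max A < 0\<close> by fastforce
  moreover have "pderiv p \<noteq> 0" using deg by (auto simp: pderiv_eq_0_iff)
  moreover have "degree (pderiv p) \<le> m" by (simp add: degree_pderiv deg)
  ultimately show ?thesis using B unfolding neg_rooted_def by blast
qed

text \<open>Inversion keeps negative roots negative and distinct. Reversal lets differentiation,
  which removes the lowest coefficient, also remove the highest one.\<close>

lemma neg_rooted_reflect_poly:
  assumes "neg_rooted m p"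
  shows "neg_rooted m (reflect_poly p)"
proof -
  obtain A where A: "finite A" "card A = m" "\<forall>x\<in>A. x < 0 \<and> poly p x = 0" and p: "p \<noteq> 0" "degree p \<le> m"
    using assms by (auto simp: neg_rooted_def)
  have "card (inverse ` A) = m" using A by (subst card_image) (auto simp: inj_on_def)
  moreover have "\<forall>x\<in>inverse ` A. x < 0 \<and> poly (reflect_poly p) x = 0"
    using A by (auto simp: poly_reflect_poly_nz)
  moreover have "degree (reflect_poly p) \<le> m"
    using degree_reflect_poly_le[of p] p by linarith
  ultimately show ?thesis using A p unfolding neg_rooted_def by (metis finite_imageI reflect_poly_eq_0_iff)
qed

lemma neg_rooted_discriminant:
  assumes "neg_rooted 2 p"
  shows "4 * coeff p 0 * coeff p 2 \<le> (coeff p 1)\<^sup>2"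
proof -
  have "degree p = 2" by (rule neg_rooted_degree[OF assms])
  obtain A where A: "card A = 2" "\<forall>x\<in>A. poly p x = 0"
    using assms by (auto simp: neg_rooted_def)
  then obtain x where "poly p x = 0" by (metis card_2_iff insertI1)
  then have x: "coeff p 2 * x\<^sup>2 + coeff p 1 * x + coeff p 0 = 0"
    using \<open>degree p = 2\<close> by (simp add: poly_altdef numeral_2_eq_2 algebra_simps)
  have "(coeff p 1)\<^sup>2 - 4 * coeff p 0 * coeff p 2 = (2 * coeff p 2 * x + coeff p 1)\<^sup>2
      - 4 * coeff p 2 * (coeff p 2 * x\<^sup>2 + coeff p 1 * x + coeff p 0)"
    by (simp add: power2_eq_square algebra_simps)
  also have "\<dots> \<ge> 0" using x by simp
  finally show ?thesis by simp
qed

text \<open>With these weights \<open>pderiv\<close> is an index shift up to a factor independent of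
  \<open>i\<close>, and \<open>reflect_poly\<close> is a plain reversal, so Newton's inequality
  passes through both.\<close>

definition ncoeff :: "nat \<Rightarrow> real poly \<Rightarrow> nat \<Rightarrow> real" where
  "ncoeff m p i = coeff p i / real (m choose i)"

lemma ncoeff_pderiv:
  assumes "i \<le> m"
  shows "ncoeff m (pderiv p) i = real (Suc m) * ncoeff (Suc m) p (Suc i)"
proof -
  have "real (Suc i) * real (Suc m choose Suc i) = real (Suc m) * real (m choose i)"
    using Suc_times_binomial_eq[of m i] by (metis mult.commute of_nat_mult)
  moreover have "real (m choose i) \<noteq> 0" "real (Suc m choose Suc i) \<noteq> 0"
    using assms by (auto simp: binomial_eq_0_iff simp del: binomial_Suc_Suc)
  ultimately show ?thesis by (simp add: ncoeff_def coeff_pderiv frac_eq_eq mult_ac del: binomial_Suc_Suc)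
qed

lemma ncoeff_reflect_poly:
  assumes "degree p = m" "i \<le> m"
  shows "ncoeff m (reflect_poly p) i = ncoeff m p (m - i)"
  using assms binomial_symmetric[of i m] by (simp add: ncoeff_def coeff_reflect_poly)

text \<open>Differentiation lowers the degree and \<open>i\<close> together, but stops at
  \<open>i = 1\<close>. Reversal then moves the index to the other end, where differentiation
  applies again. The process ends in degree 2 with the discriminant.\<close>

lemma Newton_inequality:
  assumes "neg_rooted m p" "1 \<le> i" "i < m"
  shows "ncoeff m p (i - 1) * ncoeff m p (i + 1) \<le> (ncoeff m p i)\<^sup>2"
  using assms
proof (induction m arbitrary: p i)
  case 0
  then show ?case by simp
next
  case (Suc m)
  have shift: "ncoeff (Suc m) q (j - 1) * ncoeff (Suc m) q (j + 1) \<le> (ncoeff (Suc m) q j)\<^sup>2"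
    if q: "neg_rooted (Suc m) q" and j: "2 \<le> j" "j \<le> m" for q j
  proof -
    have "ncoeff m (pderiv q) (j - 1 - 1) * ncoeff m (pderiv q) (j - 1 + 1) \<le> (ncoeff m (pderiv q) (j - 1))\<^sup>2"
      using j by (intro Suc.IH neg_rooted_pderiv q) auto
    then have "(real (Suc m))\<^sup>2 * (ncoeff (Suc m) q (j - 1) * ncoeff (Suc m) q (j + 1))
        \<le> (real (Suc m))\<^sup>2 * (ncoeff (Suc m) q j)\<^sup>2"
      using j by (simp add: ncoeff_pderiv Suc_diff_Suc numeral_2_eq_2 power2_eq_square mult_ac del: of_nat_Suc)
    then show ?thesis by (simp del: of_nat_Suc)
  qed
  show ?case
  proof (cases "2 \<le> i")
    case True
    then show ?thesis using shift Suc.prems by simp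
  next
    case False
    then have i: "i = 1" using Suc.prems by simp
    show ?thesis
    proof (cases "m = 1")
      case True
      then show ?thesis
        using neg_rooted_discriminant[of p] Suc.prems i
        by (simp add: ncoeff_def numeral_2_eq_2[symmetric] power_divide)
    next
      case False
      have deg: "degree p = Suc m" by (rule neg_rooted_degree[OF Suc.prems(1)])
      \<comment> \<open>Reversal in degree \<open>Suc m\<close> sends the index 1 to
        \<open>m\<close>, and here \<open>m\<close> is at least 2.\<close>
      show ?thesis
        using shift[OF neg_rooted_reflect_poly[OF Suc.prems(1)], of m] Suc.prems i False deg
        by (simp add: ncoeff_reflect_poly mult.commute numeral_2_eq_2)
    qed
  qed
qed

section \<open>Sign changes at simple roots, and continuous families of polynomials\<close>

lemma poly_sign_change_at_root:
  fixes p :: "real poly"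
  assumes "p \<noteq> 0" "degree p \<le> card A" "finite A" "\<forall>x\<in>A. poly p x = 0" "r \<in> A"
    and "d > 0" "{r - d..r + d} \<inter> A = {r}"
  shows "poly p (r - d) * poly p (r + d) < 0"
proof -
  obtain q where q: "p = [:- r, 1:] * q" using assms by (metis dvdE poly_eq_0_iff_dvd)
  have "q \<noteq> 0" using q assms by auto
  have dq: "degree p = Suc (degree q)" using q \<open>q \<noteq> 0\<close> assms(1) by (simp add: degree_mult_eq del: mult_pCons_left)
  \<comment> \<open>\<open>p\<close> has as many known roots as its degree allows, so the cofactor
    \<open>q\<close> has only the others. None of them lies in the interval, where \<open>q\<close>
    therefore keeps its sign.\<close>
  have roots: "{x. poly q x = 0} = A - {r}"
  proof -
    have "A - {r} \<subseteq> {x. poly q x = 0}" using assms(4) q by auto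
    moreover have "card {x. poly q x = 0} \<le> card (A - {r})"
      using card_poly_roots_bound[OF \<open>q \<noteq> 0\<close>] assms dq by simp
    ultimately show ?thesis using card_seteq poly_roots_finite[OF \<open>q \<noteq> 0\<close>] by metis
  qed
  have nz: "poly q x \<noteq> 0" if "x \<in> {r - d..r + d}" for x
    using that roots assms(7) by (metis DiffE Int_iff mem_Collect_eq singleton_iff)
  have "poly q (r - d) * poly q (r + d) > 0"
  proof (rule ccontr)
    assume "\<not> poly q (r - d) * poly q (r + d) > 0"
    moreover have "poly q (r - d) * poly q (r + d) \<noteq> 0" using nz assms(6) by simp
    ultimately have "poly q (r - d) * poly q (r + d) < 0" by linarith
    then obtain x where "x > r - d" "x < r + d" "poly q x = 0"
      using poly_IVT[of "r - d" "r + d" q] assms(6) by auto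
    then show False using nz[of x] by simp
  qed
  then have "- (d * d) * (poly q (r - d) * poly q (r + d)) < 0"
    using assms(6) by (intro mult_neg_pos) auto
  moreover have "poly p (r - d) = - d * poly q (r - d)" "poly p (r + d) = d * poly q (r + d)"
    unfolding q poly_mult by simp_all
  ultimately show ?thesis by (simp add: mult_ac)
qed

text \<open>The degree of \<open>F t\<close> may drop as \<open>t\<close> varies; the uniform bound
  \<open>k\<close> turns evaluation into a sum with a fixed range.\<close>

lemma continuous_on_poly_param:
  fixes F :: "real \<Rightarrow> real poly"
  assumes "\<And>t. degree (F t) \<le> k" "\<And>j. continuous_on UNIV (\<lambda>t. coeff (F t) j)"
    "continuous_on S f" "continuous_on S g"
  shows "continuous_on S (\<lambda>s. poly (F (f s)) (g s))"
proof -
  have "poly (F t) z = (\<Sum>j\<le>k. coeff (F t) j * z ^ j)" for t z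
    unfolding poly_altdef by (rule sum.mono_neutral_left) (use assms(1) in \<open>auto simp: coeff_eq_0\<close>)
  moreover have "continuous_on S (\<lambda>s. coeff (F (f s)) j)" for j
    using continuous_on_compose2[OF assms(2) assms(3)] by auto
  ultimately show ?thesis by (auto intro!: continuous_intros assms)
qed

section \<open>The polynomials \<open>L_k\<close>\<close>

text \<open>The recurrence comes from differentiating the identity for L_k along \<open>x\<close>.
  The linear factor is \<open>(k + 2) * (1 + t * z) + t * (1 + z) - (k + 1)\<close>: the first two
  terms come from differentiating \<open>y ^ (k + 2)\<close> and \<open>1 + t * z\<close>, the last
  from \<open>u ^ (k + 1)\<close> on the left.\<close>

primrec keel_flow :: "nat \<Rightarrow> real \<Rightarrow> real poly" where
  "keel_flow 0 t = 1"
| "keel_flow (Suc k) t = [:1 + t, real (k + 3) * t:] * keel_flow k t + [:1, 1:] * [:1, t:] * pderiv (keel_flow k t)"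

lemma degree_keel_flow: "degree (keel_flow k t) \<le> k"
proof (induction k)
  case (Suc k)
  have "degree ([:1 + t, real (k + 3) * t:] * keel_flow k t) \<le> Suc k"
    by (rule order_trans[OF degree_mult_le]) (use Suc in \<open>auto simp: degree_pCons_eq_if\<close>)
  moreover have "degree ([:1, 1:] * [:1, t:] * pderiv (keel_flow k t)) \<le> Suc k"
  proof (cases k)
    case 0
    then show ?thesis by simp
  next
    case (Suc l)
    have "degree ([:1, 1:] * [:1, t:]) \<le> 2"
      by (rule order_trans[OF degree_mult_le]) simp
    moreover have "degree (pderiv (keel_flow k t)) \<le> l"
      using Suc Suc.IH by (simp add: degree_pderiv)
    ultimately show ?thesis
      using degree_mult_le[of "[:1, 1:] * [:1, t:]" "pderiv (keel_flow k t)"] Suc by linarith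
  qed
  ultimately show ?case unfolding keel_flow.simps by (rule degree_add_le)
qed simp

lemma coeff_keel_flow_Suc:
  "coeff (keel_flow (Suc k) t) j = (1 + t) * coeff (keel_flow k t) j
    + (if j = 0 then 0 else real (k + 3) * t * coeff (keel_flow k t) (j - 1))
    + real (Suc j) * coeff (keel_flow k t) (Suc j) + (1 + t) * real j * coeff (keel_flow k t) j
    + (if j = 0 then 0 else t * real (j - 1) * coeff (keel_flow k t) (j - 1))"
  by (cases j) (auto simp: coeff_pderiv coeff_pCons algebra_simps split: nat.split)

text \<open>The leading terms add up to \<open>(k + 3) + k\<close> times \<open>t\<close>. At
  \<open>t = 0\<close> the polynomial collapses to the constant 1.\<close>

lemma lead_coeff_keel_flow:
  assumes "t \<noteq> 0"
  shows "coeff (keel_flow k t) k \<noteq> 0"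
proof (induction k)
  case (Suc k)
  have "coeff (keel_flow k t) j = 0" if "j > k" for j
    using degree_keel_flow[of k t] that by (intro coeff_eq_0) linarith
  then have "coeff (keel_flow (Suc k) t) (Suc k) = (real (2 * k + 3) * t) * coeff (keel_flow k t) k"
    by (simp add: coeff_keel_flow_Suc algebra_simps del: keel_flow.simps)
  then show ?case using Suc assms by (simp del: of_nat_add of_nat_mult)
qed simp

lemma keel_flow_neq_0: "t \<noteq> 0 \<Longrightarrow> keel_flow k t \<noteq> 0"
  using lead_coeff_keel_flow[of t k] by auto

lemma continuous_on_coeff_keel_flow: "continuous_on UNIV (\<lambda>t. coeff (keel_flow k t) j)"
proof (induction k arbitrary: j)
  case (Suc k)
  then show ?case unfolding coeff_keel_flow_Suc
    by (cases "j = 0") (auto intro!: continuous_intros Suc)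
qed simp

lemmas continuous_on_keel_flow = continuous_on_poly_param[OF degree_keel_flow continuous_on_coeff_keel_flow]

lemma keel_flow_at_0: "keel_flow k 0 = 1"
  by (induction k) (auto simp: one_pCons)

text \<open>Up to factors positive inside the interval, L_(k+1) is the derivative of L_k times
  \<open>(1 + z) powr \<alpha> * (1 + t * z) powr \<beta>\<close>. Comparing coefficients gives
  \<alpha> + \<beta> = k + 3 and \<alpha> + t \<beta> = 1 + t. Both exponents are positive for
  \<open>t < 0\<close>, so the product is continuous up to the ends of the interval and vanishes
  there. These two new zeros and the \<open>k\<close> old ones yield \<open>k + 1\<close> critical
  points.\<close>

lemma ex_roots_keel_flow:
  assumes "t < 0"
  shows "\<exists>A. finite A \<and> card A = k \<and> A \<subseteq> {-1<..<-1/t} \<and> (\<forall>z\<in>A. poly (keel_flow k t) z = 0)"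
proof (induction k)
  case (Suc k)
  then obtain A where A: "finite A" "card A = k" "A \<subseteq> {-1<..<-1/t}" "\<forall>z\<in>A. poly (keel_flow k t) z = 0"
    by blast
  \<comment> \<open>The exponents are chosen so that the derivative of \<open>g\<close> below is a multiple of the next polynomial.\<close>
  define \<beta> where "\<beta> = (real k + 2 - t) / (1 - t)"
  define \<alpha> where "\<alpha> = (1 - (real k + 2) * t) / (1 - t)"
  define g where "g z = (1 + z) powr \<alpha> * (1 + t * z) powr \<beta> * poly (keel_flow k t) z" for z
  define A' where "A' = insert (-1) (insert (-1/t) A)"
  have t1: "1 - t > 0" using assms by simp
  have pos: "\<alpha> > 0" "\<beta> > 0"
    using assms by (auto simp: \<alpha>_def \<beta>_def mult_pos_neg intro!: divide_pos_pos)
     (smt (verit) mult_pos_neg of_nat_0_le_iff)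
  have weight: "\<alpha> * (1 + t * z) + \<beta> * t * (1 + z) = 1 + t + real (k + 3) * t * z" for z
  proof -
    have "(1 - t) * (\<alpha> * (1 + t * z) + \<beta> * t * (1 + z))
        = ((1 - t) * \<alpha>) * (1 + t * z) + ((1 - t) * \<beta>) * t * (1 + z)" by (simp add: algebra_simps)
    also have "\<dots> = (1 - (real k + 2) * t) * (1 + t * z) + (real k + 2 - t) * t * (1 + z)"
      using t1 by (simp add: \<alpha>_def \<beta>_def)
    also have "\<dots> = (1 - t) * (1 + t + real (k + 3) * t * z)" by (simp add: algebra_simps)
    finally show ?thesis using t1 by simp
  qed
  have lt: "-1 < -1/t" using assms by (simp add: field_simps)
  have pos1: "1 + t * z \<ge> 0" if "z \<le> -1/t" for z using that assms by (simp add: field_simps)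
  have pos2: "1 + t * z > 0" if "z < -1/t" for z using that assms by (simp add: field_simps)
  have A': "finite A'" "card A' = Suc (Suc k)" "A' \<subseteq> {-1..-1/t}"
  proof -
    have "- 1 / t \<notin> A" "- 1 \<notin> insert (- 1 / t) A" using A(3) lt by auto
    then show "card A' = Suc (Suc k)"
      unfolding A'_def using A(1,2) by (metis card_insert_disjoint finite_insert)
    have "A \<subseteq> {-1..-1/t}" using A(3) by (rule order_trans) auto
    then show "A' \<subseteq> {-1..-1/t}" using lt by (simp add: A'_def)
  qed (simp add: A'_def A(1))
  have "\<exists>B. finite B \<and> card B = Suc k \<and> B \<subseteq> {Min A'<..<Max A'} \<and>
     (\<forall>z\<in>B. (1 + z) powr (\<alpha> - 1) * (1 + t * z) powr (\<beta> - 1) * poly (keel_flow (Suc k) t) z = 0)"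
  proof (rule Rolle_finite[OF A'])
    show "g z = 0" if "z \<in> A'" for z
    proof -
      have "1 + z = 0 \<or> 1 + t * z = 0 \<or> poly (keel_flow k t) z = 0"
        using that A(4) assms unfolding A'_def by fastforce
      then show ?thesis unfolding g_def by (elim disjE) simp_all
    qed
    show "continuous_on {-1..-1/t} g"
      unfolding g_def using pos pos1
      by (intro continuous_intros continuous_on_powr') (auto simp: add_nonneg_nonneg)
    show "(g has_real_derivative (1 + z) powr (\<alpha> - 1) * (1 + t * z) powr (\<beta> - 1) * poly (keel_flow (Suc k) t) z) (at z)"
      if z: "-1 < z" "z < -1/t" for z
    proof -
      have p: "1 + z > 0" "1 + t * z > 0" using z pos2 by auto
      have split: "(1 + z) powr \<alpha> = (1 + z) powr (\<alpha> - 1) * (1 + z)"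
        "(1 + t * z) powr \<beta> = (1 + t * z) powr (\<beta> - 1) * (1 + t * z)"
        using p powr_add[of "1 + z" "\<alpha> - 1" 1] powr_add[of "1 + t * z" "\<beta> - 1" 1] by auto
      have "(g has_real_derivative
          (\<alpha> * (1 + z) powr (\<alpha> - 1)) * (1 + t * z) powr \<beta> * poly (keel_flow k t) z
          + (1 + z) powr \<alpha> * (\<beta> * t * (1 + t * z) powr (\<beta> - 1)) * poly (keel_flow k t) z
          + (1 + z) powr \<alpha> * (1 + t * z) powr \<beta> * poly (pderiv (keel_flow k t)) z) (at z)"
        unfolding g_def using p
        by (auto intro!: derivative_eq_intros simp: powr_diff field_simps)
      also have "(\<alpha> * (1 + z) powr (\<alpha> - 1)) * (1 + t * z) powr \<beta> * poly (keel_flow k t) z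
          + (1 + z) powr \<alpha> * (\<beta> * t * (1 + t * z) powr (\<beta> - 1)) * poly (keel_flow k t) z
          + (1 + z) powr \<alpha> * (1 + t * z) powr \<beta> * poly (pderiv (keel_flow k t)) z
        = (1 + z) powr (\<alpha> - 1) * (1 + t * z) powr (\<beta> - 1) *
          ((\<alpha> * (1 + t * z) + \<beta> * t * (1 + z)) * poly (keel_flow k t) z
           + (1 + z) * (1 + t * z) * poly (pderiv (keel_flow k t)) z)"
        unfolding split by (simp add: algebra_simps)
      also have "(\<alpha> * (1 + t * z) + \<beta> * t * (1 + z)) * poly (keel_flow k t) z
           + (1 + z) * (1 + t * z) * poly (pderiv (keel_flow k t)) z = poly (keel_flow (Suc k) t) z"
        unfolding weight by (simp add: algebra_simps)
      finally show ?thesis .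
    qed
  qed
  then obtain B where B: "finite B" "card B = Suc k" "B \<subseteq> {Min A'<..<Max A'}"
     "\<forall>z\<in>B. (1 + z) powr (\<alpha> - 1) * (1 + t * z) powr (\<beta> - 1) * poly (keel_flow (Suc k) t) z = 0"
    by blast
  have "Min A' \<in> A'" "Max A' \<in> A'" using A'(1,2) by (metis Min_in Max_in card.empty nat.distinct(1))+
  then have sub: "B \<subseteq> {-1<..<-1/t}" using A'(3) B(3) by (fastforce simp: subset_iff)
  have "poly (keel_flow (Suc k) t) z = 0" if "z \<in> B" for z
  proof -
    have "-1 < z" "z < -1/t" using sub that by auto
    then show ?thesis using B(4) that pos2[of z] by (auto simp del: keel_flow.simps)
  qed
  then show ?case using B sub by blast
qed simp

text \<open>Rescaling of \<^const>\<open>keel_flow\<close> that stays regular as \<open>t = 1 / s\<close> tends to minus infinity.\<close>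

primrec keel_flow_scaled :: "nat \<Rightarrow> real \<Rightarrow> real poly" where
  "keel_flow_scaled 0 s = 1"
| "keel_flow_scaled (Suc k) s = [:1 + s, - real (k + 3) * s:] * keel_flow_scaled k s + [:1, - s:] * [:-1, 1:] * pderiv (keel_flow_scaled k s)"

text \<open>With \<open>t = 1 / s\<close>, the substitution \<open>z = - s * r\<close> carries
  \<open>0 <= z < -1/t\<close> to \<open>0 <= r < 1\<close>, and \<open>s ^ k\<close> clears the
  denominators. The recursive definition also makes sense at \<open>s = 0\<close>.\<close>

lemma keel_flow_scaled_eq:
  assumes "s \<noteq> 0"
  shows "keel_flow_scaled k s = smult (s ^ k) (pcompose (keel_flow k (1 / s)) [:0, - s:])"
proof (induction k)
  case (Suc k)
  have "poly (keel_flow_scaled (Suc k) s) r = poly (smult (s ^ Suc k) (pcompose (keel_flow (Suc k) (1 / s)) [:0, - s:])) r" for r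
    using assms by (simp add: Suc poly_pcompose pderiv_smult pderiv_pcompose pderiv_pCons field_simps)
  then show ?case by (simp add: poly_eq_poly_eq_iff[symmetric] fun_eq_iff)
qed (simp add: pcompose_1)

lemma degree_keel_flow_scaled: "degree (keel_flow_scaled k s) \<le> k"
proof (cases "s = 0")
  case True
  have "keel_flow_scaled k 0 = 1" by (induction k) (auto simp: one_pCons)
  then show ?thesis using True by simp
next
  case False
  then show ?thesis using degree_keel_flow[of k "1 / s"] by (simp add: keel_flow_scaled_eq degree_pcompose)
qed

lemma coeff_keel_flow_scaled_Suc:
  "coeff (keel_flow_scaled (Suc k) s) j = (1 + s) * coeff (keel_flow_scaled k s) j
    - (if j = 0 then 0 else real (k + 3) * s * coeff (keel_flow_scaled k s) (j - 1))
    - real (Suc j) * coeff (keel_flow_scaled k s) (Suc j) + (1 + s) * real j * coeff (keel_flow_scaled k s) j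
    - (if j = 0 then 0 else s * real (j - 1) * coeff (keel_flow_scaled k s) (j - 1))"
  by (cases j) (auto simp: coeff_pderiv coeff_pCons algebra_simps split: nat.split)

lemma continuous_on_coeff_keel_flow_scaled: "continuous_on UNIV (\<lambda>t. coeff (keel_flow_scaled k t) j)"
proof (induction k arbitrary: j)
  case (Suc k)
  then show ?case unfolding coeff_keel_flow_scaled_Suc
    by (cases "j = 0") (auto intro!: continuous_intros Suc)
qed simp

lemma keel_flow_scaled_at_0: "keel_flow_scaled k 0 = 1"
  by (induction k) (auto simp: one_pCons)

section \<open>Roots crossing zero\<close>

text \<open>Positivity is an open condition in both variables and holds on the compact segment over
  the parameter 0; the tube lemma makes the bound uniform in \<open>z\<close>.\<close>

lemma poly_param_pos_near_0:
  fixes F :: "real \<Rightarrow> real poly"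
  assumes "\<And>t. degree (F t) \<le> k" "\<And>j. continuous_on UNIV (\<lambda>t. coeff (F t) j)" "F 0 = 1"
  shows "\<exists>e>0. \<forall>t z. \<bar>t\<bar> < e \<longrightarrow> z \<in> {a..b} \<longrightarrow> poly (F t) z > 0"
proof -
  define W where "W = {(t, z). 0 < poly (F t) z}"
  have "open {x :: real \<times> real. 0 < poly (F (fst x)) (snd x)}"
    by (intro open_Collect_less continuous_on_poly_param[OF assms(1,2)] continuous_intros)
  then have "open W" by (simp add: W_def case_prod_unfold)
  moreover have "{0} \<times> {a..b} \<subseteq> W" using assms(3) by (auto simp: W_def)
  ultimately obtain X where X: "0 \<in> X" "open X" "X \<times> {a..b} \<subseteq> W"
    using Elementary_Topology.tube_lemma[of "{a..b}" W 0] by auto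
  then obtain e where "e > 0" "ball 0 e \<subseteq> X" by (meson open_contains_ball)
  then have "\<forall>t z. \<bar>t\<bar> < e \<longrightarrow> z \<in> {a..b} \<longrightarrow> poly (F t) z > 0"
    using X(3) by (force simp: W_def subset_iff)
  with \<open>e > 0\<close> show ?thesis by blast
qed

definition keel_roots :: "nat \<Rightarrow> real \<Rightarrow> real set" where
  "keel_roots k t = {z. poly (keel_flow k t) z = 0}"

text \<open>The \<open>k\<close> roots found by Rolle's theorem exhaust the degree bound, so they
  are all the roots, and simple.\<close>

lemma
  assumes "t < 0"
  shows finite_keel_roots: "finite (keel_roots k t)"
    and card_keel_roots: "card (keel_roots k t) = k"
    and keel_roots_subset: "keel_roots k t \<subseteq> {-1<..<-1/t}"
proof -
  have nz: "keel_flow k t \<noteq> 0" using keel_flow_neq_0 assms by simp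
  show fin: "finite (keel_roots k t)" unfolding keel_roots_def by (rule poly_roots_finite[OF nz])
  obtain A where A: "finite A" "card A = k" "A \<subseteq> {-1<..<-1/t}" "\<forall>z\<in>A. poly (keel_flow k t) z = 0"
    using ex_roots_keel_flow[OF assms] by blast
  have "A \<subseteq> keel_roots k t" using A by (auto simp: keel_roots_def)
  moreover have "card (keel_roots k t) \<le> card A"
    using card_poly_roots_bound[OF nz] degree_keel_flow[of k t] A by (simp add: keel_roots_def)
  ultimately have "keel_roots k t = A" using card_seteq[OF fin] by blast
  then show "card (keel_roots k t) = k" "keel_roots k t \<subseteq> {-1<..<-1/t}" using A by auto
qed

text \<open>The number of roots in an open set cannot drop under a small change of \<open>t\<close>:
  each simple root is caught by a sign change, which persists.\<close>

lemma open_card_keel_roots_ge: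
  assumes "open U"
  shows "open {t. t < 0 \<and> j \<le> card (keel_roots k t \<inter> U)}"
proof (subst open_subopen, intro ballI)
  fix t0 assume "t0 \<in> {t. t < 0 \<and> j \<le> card (keel_roots k t \<inter> U)}"
  then have t0: "t0 < 0" "j \<le> card (keel_roots k t0 \<inter> U)" by auto
  define R where "R = keel_roots k t0 \<inter> U"
  have R: "finite R" using finite_keel_roots[OF t0(1)] by (simp add: R_def)
  \<comment> \<open>A common radius \<open>d\<close>: the intervals around the roots in
    \<open>R\<close> stay in \<open>U\<close>, are pairwise disjoint, and each contains no other
    root. The factor 2 gives the disjointness, which keeps the perturbed roots distinct.\<close>
  have "\<forall>\<^sub>F d in at_right 0. \<forall>r\<in>R. (\<forall>r'\<in>keel_roots k t0. r' \<noteq> r \<longrightarrow> 2 * d < \<bar>r - r'\<bar>) \<and> {r - d..r + d} \<subseteq> U"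
  proof (intro eventually_ball_finite R ballI eventually_conj finite_keel_roots t0)
    fix r r' :: real
    show "\<forall>\<^sub>F d in at_right 0. r' \<noteq> r \<longrightarrow> 2 * d < \<bar>r - r'\<bar>"
    proof (cases "r' = r")
      case False
      then have "\<forall>\<^sub>F d in at_right 0. d < \<bar>r - r'\<bar> / 2"
        by (intro order_tendstoD(2)[OF tendsto_ident_at]) auto
      then show ?thesis by eventually_elim auto
    qed auto
  next
    fix r assume "r \<in> R"
    then obtain e where e: "e > 0" "ball r e \<subseteq> U"
      using assms by (metis Int_iff R_def open_contains_ball)
    have "\<forall>\<^sub>F d in at_right 0. d < e"
      by (intro order_tendstoD(2)[OF tendsto_ident_at]) (use e in auto)
    then show "\<forall>\<^sub>F d in at_right 0. {r - d..r + d} \<subseteq> U"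
    proof eventually_elim
      case (elim d)
      have "{r - d..r + d} \<subseteq> ball r e" using elim by (auto simp: dist_real_def)
      then show ?case using e by blast
    qed
  qed
  with eventually_at_right_less[of "0 :: real"]
  have "\<forall>\<^sub>F d in at_right 0. 0 < d \<and> (\<forall>r\<in>R. (\<forall>r'\<in>keel_roots k t0. r' \<noteq> r \<longrightarrow> 2 * d < \<bar>r - r'\<bar>) \<and> {r - d..r + d} \<subseteq> U)"
    by eventually_elim auto
  then obtain d where d: "d > 0" "\<And>r r'. r \<in> R \<Longrightarrow> r' \<in> keel_roots k t0 \<Longrightarrow> r' \<noteq> r \<Longrightarrow> 2 * d < \<bar>r - r'\<bar>"
    "\<And>r. r \<in> R \<Longrightarrow> {r - d..r + d} \<subseteq> U"
    using eventually_happens'[OF trivial_limit_at_right_real] by blast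
  have "\<forall>\<^sub>F t in nhds t0. \<forall>r\<in>R. poly (keel_flow k t) (r - d) * poly (keel_flow k t) (r + d) < 0"
  proof (intro eventually_ball_finite R ballI)
    fix r assume r: "r \<in> R"
    have "poly (keel_flow k t0) (r - d) * poly (keel_flow k t0) (r + d) < 0"
    proof (rule poly_sign_change_at_root[where A = "keel_roots k t0"])
      show "keel_flow k t0 \<noteq> 0" using keel_flow_neq_0 t0 by simp
      show "{r - d..r + d} \<inter> keel_roots k t0 = {r}"
      proof -
        have "x = r" if "x \<in> {r - d..r + d}" "x \<in> keel_roots k t0" for x
        proof (rule ccontr)
          assume "x \<noteq> r"
          from d(2)[OF r that(2) this] that(1) d(1) show False by auto
        qed
        then show ?thesis using d(1) r by (auto simp: R_def)
      qed
      show "degree (keel_flow k t0) \<le> card (keel_roots k t0)" using degree_keel_flow card_keel_roots[OF t0(1)] by simp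
      show "\<forall>x\<in>keel_roots k t0. poly (keel_flow k t0) x = 0" by (simp add: keel_roots_def)
      show "r \<in> keel_roots k t0" using r by (simp add: R_def)
    qed (rule finite_keel_roots[OF t0(1)] d(1))+
    moreover define h where "h t = poly (keel_flow k t) (r - d) * poly (keel_flow k t) (r + d)" for t
    have "continuous_on UNIV h"
      unfolding h_def by (intro continuous_intros continuous_on_keel_flow)
    then have "isCont h t0" by (simp add: continuous_on_eq_continuous_at)
    then have "(h \<longlongrightarrow> h t0) (nhds t0)"
      unfolding isCont_def tendsto_at_iff_tendsto_nhds .
    ultimately show "\<forall>\<^sub>F t in nhds t0. poly (keel_flow k t) (r - d) * poly (keel_flow k t) (r + d) < 0"
      unfolding h_def by (rule order_tendstoD(2)[rotated])
  qed
  moreover have "\<forall>\<^sub>F t in nhds t0. t < 0"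
    using eventually_nhds_in_open[of "{..<0}" t0] t0 by simp
  ultimately have "\<forall>\<^sub>F t in nhds t0. t \<in> {t. t < 0 \<and> j \<le> card (keel_roots k t \<inter> U)}"
  proof eventually_elim
    case (elim t)
    have "\<exists>z. r - d < z \<and> z < r + d \<and> poly (keel_flow k t) z = 0" if "r \<in> R" for r
      using poly_IVT[of "r - d" "r + d" "keel_flow k t"] elim(1) that d(1) by auto
    then obtain f where f: "\<And>r. r \<in> R \<Longrightarrow> r - d < f r \<and> f r < r + d \<and> poly (keel_flow k t) (f r) = 0"
      by metis
    have "inj_on f R"
    proof (rule inj_onI, rule ccontr)
      fix r r' assume *: "r \<in> R" "r' \<in> R" "f r = f r'" "r \<noteq> r'"
      then have "2 * d < \<bar>r - r'\<bar>" using d(2)[of r r'] by (auto simp: R_def)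
      with f[OF *(1)] f[OF *(2)] *(3) show False by linarith
    qed
    moreover have "f r \<in> keel_roots k t \<inter> U" if "r \<in> R" for r
    proof -
      have "f r \<in> {r - d..r + d}" using f[OF that] by auto
      then show ?thesis using f[OF that] d(3)[OF that] by (auto simp: keel_roots_def)
    qed
    then have "f ` R \<subseteq> keel_roots k t \<inter> U" by blast
    ultimately have "card R \<le> card (keel_roots k t \<inter> U)"
      by (intro card_inj_on_le) (use finite_keel_roots elim in auto)
    then show ?case using t0 elim by (simp add: R_def)
  qed
  then show "\<exists>T. open T \<and> t0 \<in> T \<and> T \<subseteq> {t. t < 0 \<and> j \<le> card (keel_roots k t \<inter> U)}"
    unfolding eventually_nhds by blast
qed

text \<open>The lower bound -1 on the roots does not depend on \<open>t\<close>, so near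
  \<open>t = 0\<close> it suffices to exclude the compact interval from -1 to 0, where L_k is close
  to 1.\<close>

lemma ex_roots_pos: "\<exists>t<0. keel_roots k t \<subseteq> {0<..}"
proof -
  obtain e where e: "e > 0" "\<And>t z. \<bar>t\<bar> < e \<Longrightarrow> z \<in> {-1..0} \<Longrightarrow> poly (keel_flow k t) z > 0"
    using poly_param_pos_near_0[OF degree_keel_flow continuous_on_coeff_keel_flow keel_flow_at_0] by blast
  have "z > 0" if "z \<in> keel_roots k (- e / 2)" for z
  proof (rule ccontr)
    assume "\<not> z > 0"
    then have "z \<in> {-1..0}" using keel_roots_subset[of "- e / 2" k] that e(1) by auto
    then show False using e(2)[of "- e / 2" z] that e(1) by (simp add: keel_roots_def)
  qed
  then show ?thesis using e(1) by (intro exI[of _ "- e / 2"]) auto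
qed

text \<open>As \<open>t\<close> tends to minus infinity, the room for nonnegative roots shrinks to
  0. Rescaling turns it into the fixed interval from 0 to 1, on which the rescaled polynomial is
  close to 1.\<close>

lemma ex_roots_neg: "\<exists>t<0. keel_roots k t \<subseteq> {..<0}"
proof -
  obtain e where e: "e > 0" "\<And>s r. \<bar>s\<bar> < e \<Longrightarrow> r \<in> {0..1} \<Longrightarrow> poly (keel_flow_scaled k s) r > 0"
    using poly_param_pos_near_0[OF degree_keel_flow_scaled continuous_on_coeff_keel_flow_scaled keel_flow_scaled_at_0] by blast
  define s where "s = - e / 2"
  have s: "s < 0" "\<bar>s\<bar> < e" using e(1) by (auto simp: s_def)
  have "z < 0" if "z \<in> keel_roots k (1 / s)" for z
  proof (rule ccontr)
    assume "\<not> z < 0"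
    moreover have "z < - s" using keel_roots_subset[of "1 / s" k] that s by auto
    ultimately have "z / (- s) \<in> {0..1}" using s by (auto simp: field_simps)
    then have "poly (keel_flow_scaled k s) (z / (- s)) > 0" using e(2) s by blast
    then show False using that s by (simp add: keel_flow_scaled_eq poly_pcompose keel_roots_def)
  qed
  then show ?thesis using s by (intro exI[of _ "1 / s"]) auto
qed

text \<open>The parameters with more than \<open>j\<close> positive roots and those with at least
  \<open>k - j\<close> negative roots form disjoint nonempty open sets, which cannot cover a
  connected half-line. At a parameter outside both, the count falls short of \<open>k\<close> unless
  0 is a root. Recording \<open>j\<close> in the conclusion makes the crossings
  distinguishable.\<close>

lemma ex_root_crossing:
  assumes "j < k"
  shows "\<exists>t<0. poly (keel_flow k t) 0 = 0 \<and> card (keel_roots k t \<inter> {0<..}) = j"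
proof -
  define S where "S = {t. t < 0 \<and> Suc j \<le> card (keel_roots k t \<inter> {0<..})}"
  define C where "C = {t. t < 0 \<and> k - j \<le> card (keel_roots k t \<inter> {..<0})}"
  have split: "card (keel_roots k t \<inter> {0<..}) + card (keel_roots k t \<inter> {..<0}) + card (keel_roots k t \<inter> {0}) = k"
    if "t < 0" for t
  proof -
    define P N Z where "P = keel_roots k t \<inter> {0<..}" and "N = keel_roots k t \<inter> {..<0}"
      and "Z = keel_roots k t \<inter> {0}"
    have "finite P" "finite N" "finite Z"
      unfolding P_def N_def Z_def by (intro finite_Int disjI1 finite_keel_roots that)+
    moreover have "P \<inter> N = {}" "(P \<union> N) \<inter> Z = {}"
      by (force simp: P_def N_def Z_def)+
    ultimately have "card (P \<union> N \<union> Z) = card P + card N + card Z"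
      by (metis card_Un_disjoint finite_Un)
    moreover have "P \<union> N \<union> Z = keel_roots k t"
      unfolding P_def N_def Z_def using linorder_less_linear[of _ "0 :: real"] by blast
    ultimately show ?thesis
      using card_keel_roots[OF that, of k] unfolding P_def N_def Z_def by metis
  qed
  have "\<exists>t\<in>{..<0}. t \<notin> S \<union> C"
  proof (rule ccontr)
    assume "\<not> (\<exists>t\<in>{..<0}. t \<notin> S \<union> C)"
    then have "{..<0} \<subseteq> S \<union> C" by auto
    moreover have "open S" "open C" unfolding S_def C_def by (rule open_card_keel_roots_ge; simp)+
    moreover have "S \<inter> C \<inter> {..<0} = {}" using split assms by (fastforce simp: S_def C_def)
    moreover obtain t1 where "t1 < 0" "keel_roots k t1 \<subseteq> {0<..}" using ex_roots_pos by blast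
    then have "t1 \<in> S" using card_keel_roots[of t1 k] assms by (simp add: S_def Int_absorb2)
    then have "S \<inter> {..<0} \<noteq> {}" using \<open>t1 < 0\<close> by auto
    moreover obtain t2 where "t2 < 0" "keel_roots k t2 \<subseteq> {..<0}" using ex_roots_neg by blast
    then have "t2 \<in> C" using card_keel_roots[of t2 k] assms by (simp add: C_def Int_absorb2)
    then have "C \<inter> {..<0} \<noteq> {}" using \<open>t2 < 0\<close> by auto
    ultimately show False using connectedD[OF connected_Iio, of S C 0] by blast
  qed
  then obtain t where t: "t < 0" "card (keel_roots k t \<inter> {0<..}) \<le> j" "card (keel_roots k t \<inter> {..<0}) + j < k"
    by (auto simp: S_def C_def)
  \<comment> \<open>At most \<open>j\<close> positive roots, at most \<open>k - j - 1\<close>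
    negative ones and at most one zero must add up to \<open>k\<close>, so every bound is
    attained.\<close>
  have "card (keel_roots k t \<inter> {0}) \<le> 1" using card_mono[of "{0 :: real}" "keel_roots k t \<inter> {0}"] by simp
  then have "card (keel_roots k t \<inter> {0<..}) = j" "card (keel_roots k t \<inter> {0}) \<noteq> 0"
    using split[OF t(1)] t by linarith+
  moreover from this(2) have "poly (keel_flow k t) 0 = 0" by (cases "0 \<in> keel_roots k t") (auto simp: keel_roots_def)
  ultimately show ?thesis using t by blast
qed

text \<open>The crossing parameters for different \<open>j\<close> differ, since the number of
  positive roots is a function of the parameter.\<close>

lemma neg_rooted_keel_flow_at_0:
  assumes "\<And>t. poly p t = poly (keel_flow k t) 0" "degree p \<le> k"
  shows "neg_rooted k p"
proof -
  have "poly p 0 = 1" unfolding assms(1)[of 0] keel_flow_at_0 by simp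
  then have "p \<noteq> 0" by auto
  have "\<forall>j. \<exists>t. j < k \<longrightarrow> t < 0 \<and> poly (keel_flow k t) 0 = 0 \<and> card (keel_roots k t \<inter> {0<..}) = j"
    using ex_root_crossing by blast
  from choice[OF this] obtain f where
    f: "\<forall>j. j < k \<longrightarrow> f j < 0 \<and> poly (keel_flow k (f j)) 0 = 0 \<and> card (keel_roots k (f j) \<inter> {0<..}) = j" ..
  have "inj_on f {..<k}"
  proof (rule inj_onI)
    fix i j assume *: "i \<in> {..<k}" "j \<in> {..<k}" "f i = f j"
    have "card (keel_roots k (f i) \<inter> {0<..}) = i" "card (keel_roots k (f j) \<inter> {0<..}) = j"
      using f * by blast+
    with *(3) show "i = j" by metis
  qed
  then have "card (f ` {..<k}) = k" by (simp add: card_image)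
  moreover have "\<forall>x\<in>f ` {..<k}. x < 0 \<and> poly p x = 0"
    unfolding assms(1) using f by blast
  ultimately show ?thesis
    unfolding neg_rooted_def using \<open>p \<noteq> 0\<close> assms(2) by blast
qed

section \<open>The generating function of the recurrence\<close>

unbundle no vec_syntax and fps_syntax

text \<open>Comparison of coefficients. The convention \<open>P 2 = 1\<close> gives \<phi> its
  linear term, and hence the convolution two end terms outside the range of the recurrence.\<close>

lemma keel_fps_ode:
  fixes P :: "nat \<Rightarrow> real" and t :: real
  assumes P: "P 2 = 1" "P 3 = 1"
    and rec: "\<And>m. m > 3 \<Longrightarrow> P m = (1 + t) * P (m - 1) +
       t * (\<Sum>j = 3..m - 2. real ((m - 2) choose (j - 1)) * P j * P (m + 1 - j))"
  defines "\<phi> \<equiv> Abs_fps (\<lambda>n. if n = 0 then 0 else P (n + 1) / fact n)"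
  shows "(1 + fps_const t * (fps_X - \<phi>)) * fps_deriv \<phi> = 1 + \<phi>"
proof (rule fps_ext)
  fix N
  have y: "fps_deriv \<phi> $ n = P (n + 2) / fact n" for n
    by (simp add: \<phi>_def field_simps del: of_nat_Suc)
  have X: "(fps_X * fps_deriv \<phi>) $ N = (if N = 0 then 0 else P (N + 1) / fact (N - 1))"
    by (cases N) (simp_all add: y del: fps_deriv_nth)
  have prod: "(\<phi> * fps_deriv \<phi>) $ N = (\<Sum>i=1..N. real (N choose i) * P (i + 1) * P (N + 2 - i)) / fact N"
  proof -
    have "(\<phi> * fps_deriv \<phi>) $ N = (\<Sum>i=0..N. \<phi> $ i * fps_deriv \<phi> $ (N - i))"
      by (rule fps_mult_nth)
    also have "\<dots> = (\<Sum>i=1..N. \<phi> $ i * fps_deriv \<phi> $ (N - i))"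
      by (rule sum.mono_neutral_right) (auto simp: \<phi>_def)
    also have "\<dots> = (\<Sum>i=1..N. real (N choose i) * P (i + 1) * P (N + 2 - i) / fact N)"
    proof (rule sum.cong)
      fix i assume i: "i \<in> {1..N}"
      have "real (N choose i) = fact N / (fact i * fact (N - i))"
        using i by (simp add: binomial_fact)
      moreover have "N - i + 2 = N + 2 - i" using i by (simp add: Suc_diff_le)
      ultimately show "\<phi> $ i * fps_deriv \<phi> $ (N - i) = real (N choose i) * P (i + 1) * P (N + 2 - i) / fact N"
        using i unfolding y by (simp add: \<phi>_def)
    qed simp
    finally show ?thesis by (simp add: sum_divide_distrib)
  qed
  have expand: "((1 + fps_const t * (fps_X - \<phi>)) * fps_deriv \<phi>) $ N
      = fps_deriv \<phi> $ N + t * ((fps_X * fps_deriv \<phi>) $ N - (\<phi> * fps_deriv \<phi>) $ N)"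
  proof -
    have "(1 + fps_const t * (fps_X - \<phi>)) * fps_deriv \<phi>
        = fps_deriv \<phi> + fps_const t * (fps_X * fps_deriv \<phi> - \<phi> * fps_deriv \<phi>)"
      by (simp only: algebra_simps) simp
    then show ?thesis by (simp only: fps_add_nth fps_sub_nth fps_mult_left_const_nth)
  qed
  \<comment> \<open>The recurrence for \<open>P (N + 2)\<close> starts at \<open>N = 2\<close>; the
    two lower coefficients rest on \<open>P 2\<close> and \<open>P 3\<close> alone.\<close>
  consider "N = 0" | "N = 1" | "N \<ge> 2" by linarith
  then show "((1 + fps_const t * (fps_X - \<phi>)) * fps_deriv \<phi>) $ N = (1 + \<phi>) $ N"
  proof cases
    case 1
    then show ?thesis unfolding expand X prod y using P by (simp add: \<phi>_def numeral_2_eq_2)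
  next
    case 2
    then show ?thesis unfolding expand X prod y using P by (simp add: \<phi>_def numeral_eq_Suc)
  next
    case 3
    define f where "f i = real (N choose i) * P (i + 1) * P (N + 2 - i)" for i
    \<comment> \<open>The end term \<open>f 1\<close> cancels against the contribution of
      \<open>fps_X\<close>, and \<open>f N\<close> supplies the \<open>t\<close> in the factor
      \<open>1 + t\<close>.\<close>
    have "(\<Sum>i=1..N. f i) = f 1 + (\<Sum>i=2..N - 1. f i) + f N"
    proof -
      have "{1..N} = insert 1 (insert N {2..N - 1})" using 3 by auto
      then show ?thesis using 3 by simp
    qed
    also have "f 1 = real N * P (N + 1)" using P by (simp add: f_def numeral_2_eq_2)
    also have "f N = P (N + 1)" using P by (simp add: f_def numeral_2_eq_2)
    also have "(\<Sum>i=2..N - 1. f i) = (\<Sum>j=3..N. real (N choose (j - 1)) * P j * P (N + 3 - j))"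
      using 3 by (intro sum.reindex_bij_witness[of _ "\<lambda>j. j - 1" Suc]) (auto simp: f_def Suc_diff_Suc numeral_eq_Suc)
    finally have s: "(\<Sum>i=1..N. f i) = real N * P (N + 1) + (\<Sum>j=3..N. real (N choose (j - 1)) * P j * P (N + 3 - j)) + P (N + 1)"
      by simp
    have "P (N + 2) = (1 + t) * P (N + 1) + t * (\<Sum>j=3..N. real (N choose (j - 1)) * P j * P (N + 3 - j))"
      using rec[of "N + 2"] 3 by (simp add: numeral_eq_Suc)
    then have "P (N + 2) = (1 + t) * P (N + 1) + t * ((\<Sum>i=1..N. f i) - real N * P (N + 1) - P (N + 1))"
      using s by simp
    moreover have "fact N = real N * fact (N - 1)" using 3 by (simp add: fact_reduce)
    ultimately show ?thesis
      unfolding expand X prod y f_def[symmetric] using 3 by (simp add: \<phi>_def field_simps)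
  qed
qed

text \<open>In the induction step the identity is differentiated and multiplied by
  \<open>1 + \<phi>\<close>, so that each \<open>y'\<close> can be replaced without division. The
  condition \<open>y $ 0 = 1\<close> removes the constant term of \<open>y - 1\<close>, as
  composition of power series requires.\<close>

lemma fps_nth_deriv_keel_flow:
  fixes \<phi> :: "real fps" and t :: real
  defines "y \<equiv> fps_deriv \<phi>"
  assumes ode: "(1 + fps_const t * (fps_X - \<phi>)) * y = 1 + \<phi>" and y0: "y $ 0 = 1"
  shows "fps_nth_deriv (k + 2) \<phi> * (1 + \<phi>) ^ (k + 1)
    = y ^ (k + 2) * (1 + fps_const t * (y - 1)) * (fps_of_poly (keel_flow k t) oo (y - 1))"
proof -
  define c where "c = fps_const t"
  define z where "z = y - 1"
  have z0: "z $ 0 = 0" using y0 by (simp add: z_def)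
  have dz: "fps_deriv z = fps_deriv y" by (simp add: z_def)
  \<comment> \<open>The differentiated equation is multiplied by \<open>y\<close>, since the
    equation itself turns \<open>(1 + c * (fps_X - \<phi>)) * y\<close> into
    \<open>1 + \<phi>\<close>.\<close>
  have y': "(1 + \<phi>) * fps_deriv y = y\<^sup>2 * (1 + c * z)"
  proof -
    have "fps_deriv ((1 + c * (fps_X - \<phi>)) * y) = y"
      unfolding c_def ode by (simp add: y_def)
    then have "c * (1 - y) * y + (1 + c * (fps_X - \<phi>)) * fps_deriv y = y"
      by (simp add: c_def y_def[symmetric] algebra_simps)
    then have "y * (c * (1 - y) * y + (1 + c * (fps_X - \<phi>)) * fps_deriv y) = y * y" by simp
    then have "c * (1 - y) * y\<^sup>2 + (1 + c * (fps_X - \<phi>)) * y * fps_deriv y = y\<^sup>2"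
      by (simp add: algebra_simps power2_eq_square)
    then show ?thesis
      unfolding ode[folded c_def] z_def by (simp add: algebra_simps)
  qed
  have "fps_nth_deriv (k + 2) \<phi> * (1 + \<phi>) ^ (k + 1)
    = y ^ (k + 2) * (1 + c * z) * (fps_of_poly (keel_flow k t) oo z)"
  proof (induction k)
    case 0
    have "fps_nth_deriv (0 + 2) \<phi> = fps_deriv y" by (simp add: y_def numeral_2_eq_2)
    then show ?case using y' by (simp add: mult.commute power2_eq_square)
  next
    case (Suc k)
    define M where "M = fps_of_poly (keel_flow k t) oo z"
    define M' where "M' = fps_of_poly (pderiv (keel_flow k t)) oo z"
    define \<psi> where "\<psi> = fps_nth_deriv (k + 2) \<phi>"
    have dM: "fps_deriv M = M' * fps_deriv y"
      unfolding M_def M'_def using z0 dz by (simp add: fps_compose_deriv fps_of_poly_pderiv)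
    have rec: "fps_of_poly (keel_flow (Suc k) t) oo z
        = (1 + c + of_nat (k + 3) * c * z) * M + (1 + z) * (1 + c * z) * M'"
    proof -
      have lin: "fps_of_poly [:a, b:] oo z = fps_const a + fps_const b * z" for a b
        by (simp add: fps_of_poly_pCons fps_compose_add_distrib fps_compose_mult_distrib z0)
      show ?thesis
        unfolding keel_flow.simps fps_of_poly_add fps_of_poly_mult fps_compose_add_distrib
          fps_compose_mult_distrib[OF z0] lin M_def[symmetric] M'_def[symmetric]
        by (simp add: c_def algebra_simps flip: fps_of_nat fps_const_add)
    qed
    have IH: "\<psi> * (1 + \<phi>) ^ (k + 1) = y ^ (k + 2) * (1 + c * z) * M"
      using Suc by (simp add: \<psi>_def M_def)
    have d1: "fps_deriv (\<psi> * (1 + \<phi>) ^ (k + 1)) = fps_deriv \<psi> * (1 + \<phi>) ^ (k + 1) + of_nat (k + 1) * \<psi> * (1 + \<phi>) ^ k * y"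
    proof -
      have "fps_deriv ((1 + \<phi>) ^ (k + 1)) = of_nat (k + 1) * y * (1 + \<phi>) ^ k"
        unfolding fps_deriv_power' by (simp add: y_def)
      then show ?thesis unfolding fps_deriv_mult by (simp only: mult_ac add_ac)
    qed
    have 1: "(1 + \<phi>) * fps_deriv (\<psi> * (1 + \<phi>) ^ (k + 1))
        = fps_deriv \<psi> * (1 + \<phi>) ^ (k + 2) + of_nat (k + 1) * y * (\<psi> * (1 + \<phi>) ^ (k + 1))"
      unfolding d1 by (simp add: algebra_simps)
    have d2: "fps_deriv (y ^ (k + 2) * (1 + c * z) * M)
        = (of_nat (k + 2) * y ^ (k + 1) * (1 + c * z) * M + y ^ (k + 2) * c * M + y ^ (k + 2) * (1 + c * z) * M') * fps_deriv y"
    proof -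
      have "fps_deriv (y ^ (k + 2)) = of_nat (k + 2) * fps_deriv y * y ^ (k + 1)"
        unfolding fps_deriv_power' by simp
      moreover have "fps_deriv (1 + c * z) = c * fps_deriv y" by (simp add: c_def dz)
      ultimately show ?thesis unfolding fps_deriv_mult dM by (simp only: algebra_simps)
    qed
    have 2: "(1 + \<phi>) * fps_deriv (y ^ (k + 2) * (1 + c * z) * M)
        = (of_nat (k + 2) * y ^ (k + 1) * (1 + c * z) * M + y ^ (k + 2) * c * M + y ^ (k + 2) * (1 + c * z) * M') * (y\<^sup>2 * (1 + c * z))"
      unfolding y'[symmetric] d2 by (simp only: mult_ac)
    have "fps_deriv \<psi> * (1 + \<phi>) ^ (k + 2)
        = (of_nat (k + 2) * y ^ (k + 1) * (1 + c * z) * M + y ^ (k + 2) * c * M + y ^ (k + 2) * (1 + c * z) * M') * (y\<^sup>2 * (1 + c * z))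
          - of_nat (k + 1) * y * (y ^ (k + 2) * (1 + c * z) * M)"
      using 1 unfolding IH 2 by (metis add_diff_cancel_right')
    also have "\<dots> = y ^ (k + 3) * (1 + c * z) *
        ((of_nat (k + 2) * (1 + c * z) + y * c - of_nat (k + 1)) * M + y * (1 + c * z) * M')"
      by (simp add: algebra_simps power2_eq_square power_add numeral_3_eq_3)
    also have "(of_nat (k + 2) * (1 + c * z) + y * c - of_nat (k + 1)) * M + y * (1 + c * z) * M'
        = fps_of_poly (keel_flow (Suc k) t) oo z"
      unfolding rec by (simp add: z_def algebra_simps)
    finally show ?case
      by (simp add: \<psi>_def fps_nth_deriv_commute[symmetric] numeral_3_eq_3 del: keel_flow.simps fps_nth_deriv.simps)
  qed
  then show ?thesis by (simp add: c_def z_def)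
qed

text \<open>Constant terms are compared: at \<open>x = 0\<close> one has \<phi> = 0 and y = 1, so
  the composition is evaluated at \<open>z = 0\<close> and all other factors are 1.\<close>

lemma keel_recurrence_keel_flow:
  fixes P :: "nat \<Rightarrow> real" and t :: real
  assumes P: "P 2 = 1" "P 3 = 1"
    and rec: "\<And>m. m > 3 \<Longrightarrow> P m = (1 + t) * P (m - 1) +
       t * (\<Sum>j = 3..m - 2. real ((m - 2) choose (j - 1)) * P j * P (m + 1 - j))"
  shows "P (k + 3) = poly (keel_flow k t) 0"
proof -
  define \<phi> where "\<phi> = Abs_fps (\<lambda>n. if n = 0 then 0 else P (n + 1) / fact n)"
  have \<phi>0: "\<phi> $ 0 = 0" by (simp add: \<phi>_def)
  have y0: "fps_deriv \<phi> $ 0 = 1" using P by (simp add: \<phi>_def numeral_2_eq_2)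
  have "fps_nth_deriv (k + 2) \<phi> * (1 + \<phi>) ^ (k + 1) = fps_deriv \<phi> ^ (k + 2) *
      (1 + fps_const t * (fps_deriv \<phi> - 1)) * (fps_of_poly (keel_flow k t) oo (fps_deriv \<phi> - 1))"
  proof (rule fps_nth_deriv_keel_flow)
    show "(1 + fps_const t * (fps_X - \<phi>)) * fps_deriv \<phi> = 1 + \<phi>"
      unfolding \<phi>_def by (rule keel_fps_ode[OF P rec])
  qed (rule y0)
  from arg_cong[OF this, of "\<lambda>f. f $ 0"]
  have "fps_nth_deriv (k + 2) \<phi> $ 0 = coeff (keel_flow k t) 0"
    using y0 \<phi>0 by (simp add: fps_nth_power_0 del: fps_nth_deriv.simps fps_deriv_nth power_Suc)
  moreover have "fps_nth_deriv (k + 2) \<phi> $ 0 = P (k + 3)"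
    unfolding fps_deriv_maclauren_0 by (simp add: \<phi>_def numeral_3_eq_3 del: fact_Suc)
  ultimately show ?thesis by (simp add: poly_0_coeff_0)
qed

unbundle no fps_syntax and vec_syntax

section \<open>The 3-pointed moduli space\<close>

definition const_cochain :: "'a topology \<Rightarrow> ((nat \<Rightarrow> real) \<Rightarrow> 'a) \<Rightarrow> rat" where
  "const_cochain X s = (if singular_simplex 0 X s then 1 else 0)"

text \<open>Without quadruples every class is sent to the only point of an empty product, so the
  pullback topology is indiscrete whatever its carrier is.\<close>

lemma moduli_space_3_indiscrete:
  assumes "openin (moduli_space 3) U" "U \<noteq> {}"
  shows "U = topspace (moduli_space 3)"
proof -
  have "quadruples 3 = {}"
  proof (rule equals0I, clarify)
    fix i j k l :: nat assume "(i, j, k, l) \<in> quadruples 3"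
    then have "{i, j, k, l} \<subseteq> {1..3}" "card {i, j, k, l} = 4" by (auto simp: quadruples_def)
    then show False using card_mono[of "{1..3 :: nat}" "{i, j, k, l}"] by simp
  qed
  then have eq: "(\<lambda>q\<in>quadruples 3. f q) = (\<lambda>q. undefined)" for f :: "nat \<times> nat \<times> nat \<times> nat \<Rightarrow> cp1"
    by auto
  show ?thesis
    using assms unfolding moduli_space_def openin_pullback_topology topspace_pullback_topology eq
    using openin_subset by fastforce
qed

lemma singular_simplex_indiscrete:
  assumes "\<And>U. openin X U \<Longrightarrow> U \<noteq> {} \<Longrightarrow> U = topspace X"
    and "s \<in> standard_simplex p \<rightarrow>\<^sub>E topspace X"
  shows "singular_simplex p X s"
proof -
  have "openin (subtopology (powertop_real UNIV) (standard_simplex p))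
      {x \<in> topspace (subtopology (powertop_real UNIV) (standard_simplex p)). s x \<in> U}"
    if "openin X U" for U
  proof (cases "U = {}")
    case False
    then have "{x \<in> topspace (subtopology (powertop_real UNIV) (standard_simplex p)). s x \<in> U}
        = topspace (subtopology (powertop_real UNIV) (standard_simplex p))"
      using assms(1)[OF that] assms(2) by (auto simp: topspace_standard_simplex)
    then show ?thesis by (metis openin_topspace)
  qed simp
  then show ?thesis
    using assms(2) by (auto simp: singular_simplex_def continuous_map_def topspace_standard_simplex PiE_def)
qed

text \<open>In an indiscrete space any two points are joined by a singular edge, because every map
  is continuous; a 0-cocycle takes the same value at both ends.\<close>

lemma cocycles_0_indiscrete:
  assumes indisc: "\<And>U. openin X U \<Longrightarrow> U \<noteq> {} \<Longrightarrow> U = topspace X"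
    and c: "c \<in> cocycles 0 X"
  shows "\<exists>a. c = (\<lambda>s. a * const_cochain X s)"
proof -
  define e :: "nat \<Rightarrow> real" where "e = (\<lambda>j. if j = 0 then 1 else 0)"
  have S0: "standard_simplex 0 = {e}" by (simp add: standard_simplex_0 e_def)
  have eq: "c s = c s'" if s: "singular_simplex 0 X s" "singular_simplex 0 X s'" for s s'
  proof -
    have mem: "s e \<in> topspace X" "s' e \<in> topspace X" and ext: "s \<in> extensional {e}" "s' \<in> extensional {e}"
      using s by (auto simp: singular_simplex_def continuous_map_def topspace_standard_simplex S0)
    \<comment> \<open>A step function serves as the edge: it is \<open>s e\<close> at the vertex
      with \<open>x 0 = 0\<close>, which is face 0, and \<open>s' e\<close> elsewhere, in particular
      at face 1.\<close>
    define \<sigma> where "\<sigma> = (\<lambda>x\<in>standard_simplex 1. if x 0 = 0 then s e else s' e)"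
    have "singular_simplex 1 X \<sigma>"
      by (rule singular_simplex_indiscrete[OF indisc]) (use mem in \<open>auto simp: \<sigma>_def\<close>)
    moreover have "coboundary 0 X c \<sigma> = 0" using c by (simp add: cocycles_def)
    ultimately have "c (singular_face 1 0 \<sigma>) - c (singular_face 1 1 \<sigma>) = 0"
      by (simp add: coboundary_def)
    moreover have "singular_face 1 0 \<sigma> = s"
    proof
      fix x show "singular_face 1 0 \<sigma> x = s x"
        using ext simplical_face_in_standard_simplex[of 1 0 e]
        by (auto simp: singular_face_def S0 \<sigma>_def simplical_face_def extensional_def)
    qed
    moreover have "singular_face 1 1 \<sigma> = s'"
    proof
      fix x show "singular_face 1 1 \<sigma> x = s' x"
        using ext simplical_face_in_standard_simplex[of 1 1 e]
        by (auto simp: singular_face_def S0 \<sigma>_def simplical_face_def extensional_def e_def)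
    qed
    ultimately show ?thesis by simp
  qed
  have zero: "c s = 0" if "\<not> singular_simplex 0 X s" for s
    using c that by (auto simp: cocycles_def cochains_def)
  show ?thesis
  proof (cases "\<exists>s. singular_simplex 0 X s")
    case True
    then obtain s where s: "singular_simplex 0 X s" ..
    have "c s' = c s * const_cochain X s'" for s'
    proof (cases "singular_simplex 0 X s'")
      case True
      then have "c s' = c s" using s by (rule eq)
      then show ?thesis using True by (simp add: const_cochain_def)
    qed (simp add: const_cochain_def zero)
    then show ?thesis by blast
  next
    case False
    then have "c = (\<lambda>s. 0 * const_cochain X s)" using zero by auto
    then show ?thesis ..
  qed
qed

lemma const_cochain_cocycle: "(\<lambda>s. a * const_cochain X s) \<in> cocycles 0 X"
proof -
  have "singular_simplex 0 X (singular_face 1 k s)" if "singular_simplex 1 X s" "k \<le> 1" for k s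
    using singular_simplex_singular_face[OF that(1)] that(2) by simp
  then show ?thesis
    by (auto simp: cocycles_def cochains_def coboundary_def const_cochain_def fun_eq_iff)
qed

section \<open>The quotient dimension of a space spanned by one function\<close>

lemma quotient_dim_eqI:
  assumes "\<forall>j<d. e j \<in> Z"
    and "\<forall>z\<in>Z. \<exists>!a. a \<in> extensional {..<d} \<and> (\<lambda>x. z x - (\<Sum>j<d. a j * e j x)) \<in> B"
    and "\<And>d' e'. \<forall>j<d'. e' j \<in> Z \<Longrightarrow>
      \<forall>z\<in>Z. \<exists>!a. a \<in> extensional {..<d'} \<and> (\<lambda>x. z x - (\<Sum>j<d'. a j * e' j x)) \<in> B \<Longrightarrow> d' = d"
  shows "quotient_dim Z B = d"
  unfolding quotient_dim_def using assms by (intro the_equality) blast+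

text \<open>Only a bound is stated because \<open>g\<close> may vanish. As
  \<open>quotient_dim\<close> is a definite description, each case must also show that every other
  admissible \<open>d'\<close> agrees.\<close>

lemma quotient_dim_line:
  assumes Z: "Z = {\<lambda>x. a * g x |a. True}"
  shows "quotient_dim Z {\<lambda>x. 0} \<le> 1"
proof (cases "g = (\<lambda>x. 0)")
  case True
  then have Z0: "Z = {\<lambda>x. 0}" using Z by auto
  have "quotient_dim Z {\<lambda>x. 0} = 0"
  proof (rule quotient_dim_eqI)
    show "\<forall>z\<in>Z. \<exists>!a. a \<in> extensional {..<0::nat} \<and> (\<lambda>x. z x - (\<Sum>j<0::nat. a j * g x)) \<in> {\<lambda>x. 0}"
      using Z0 by (auto intro!: ex1I[of _ "\<lambda>_. undefined"])
  next
    fix d' and e' :: "nat \<Rightarrow> 'a \<Rightarrow> rat"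
    assume e': "\<forall>j<d'. e' j \<in> Z"
      and unique: "\<forall>z\<in>Z. \<exists>!a. a \<in> extensional {..<d'} \<and> (\<lambda>x. z x - (\<Sum>j<d'. a j * e' j x)) \<in> {\<lambda>x. 0}"
    show "d' = 0"
    proof (rule ccontr)
      assume "d' \<noteq> 0"
      have "\<exists>!a. a \<in> extensional {..<d'} \<and> (\<lambda>x. (0 :: rat) - (\<Sum>j<d'. a j * e' j x)) \<in> {\<lambda>x. 0}"
        using unique Z0 by auto
      \<comment> \<open>All \<open>e' j\<close> vanish, so every coefficient family represents 0,
        and uniqueness would identify the constant families 0 and 1.\<close>
      moreover have "(\<lambda>x. (0 :: rat) - (\<Sum>j<d'. a j * e' j x)) \<in> {\<lambda>x. 0}" for a
        using e' Z0 by (auto simp: fun_eq_iff)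
      ultimately have "(\<lambda>j\<in>{..<d'}. 0 :: rat) = (\<lambda>j\<in>{..<d'}. 1)"
        by (metis restrict_extensional)
      then show False using \<open>d' \<noteq> 0\<close> by (metis lessThan_iff neq0_conv restrict_apply' zero_neq_one)
    qed
  qed (use Z0 in auto)
  then show ?thesis by simp
next
  case False
  then obtain x0 where x0: "g x0 \<noteq> 0" by auto
  have "quotient_dim Z {\<lambda>x. 0} = 1"
  proof (rule quotient_dim_eqI)
    show "\<forall>j<1::nat. (\<lambda>j. g) j \<in> Z" using Z by (auto intro: exI[of _ 1])
    show "\<forall>z\<in>Z. \<exists>!a. a \<in> extensional {..<1::nat} \<and> (\<lambda>x. z x - (\<Sum>j<1::nat. a j * g x)) \<in> {\<lambda>x. 0}"
    proof
      fix z assume "z \<in> Z"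
      then obtain b where b: "z = (\<lambda>x. b * g x)" using Z by auto
      show "\<exists>!a. a \<in> extensional {..<1::nat} \<and> (\<lambda>x. z x - (\<Sum>j<1::nat. a j * g x)) \<in> {\<lambda>x. 0}"
      proof (rule ex1I[of _ "\<lambda>j\<in>{..<1::nat}. b"])
        fix a :: "nat \<Rightarrow> rat"
        assume a: "a \<in> extensional {..<1::nat} \<and> (\<lambda>x. z x - (\<Sum>j<1::nat. a j * g x)) \<in> {\<lambda>x. 0}"
        then have "b * g x0 = a 0 * g x0" by (auto simp: b fun_eq_iff)
        then have "a 0 = b" using x0 by simp
        then show "a = (\<lambda>j\<in>{..<1::nat}. b)" using a by (auto simp: extensional_def fun_eq_iff)
      qed (simp add: b)
    qed
  next
    fix d' and e' :: "nat \<Rightarrow> 'a \<Rightarrow> rat"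
    assume e': "\<forall>j<d'. e' j \<in> Z"
      and unique: "\<forall>z\<in>Z. \<exists>!a. a \<in> extensional {..<d'} \<and> (\<lambda>x. z x - (\<Sum>j<d'. a j * e' j x)) \<in> {\<lambda>x. 0}"
    have "\<forall>j. \<exists>b. j < d' \<longrightarrow> e' j = (\<lambda>x. b * g x)" using e' Z by auto
    from choice[OF this] obtain b where b: "\<forall>j. j < d' \<longrightarrow> e' j = (\<lambda>x. b j * g x)" ..
    have comb: "(\<Sum>j<d'. a j * e' j x) = (\<Sum>j<d'. a j * b j) * g x" for a x
      using b by (simp add: sum_distrib_right mult.assoc)
    have "(\<lambda>x. 0) \<in> Z" "g \<in> Z" using Z by (auto intro: exI[of _ 0] exI[of _ 1])
    have zero: "a = a'" if "a \<in> extensional {..<d'}" "a' \<in> extensional {..<d'}"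
      "(\<Sum>j<d'. a j * b j) = 0" "(\<Sum>j<d'. a' j * b j) = 0" for a a'
      using bspec[OF unique \<open>(\<lambda>x. 0) \<in> Z\<close>] that unfolding comb by auto
    have "d' \<noteq> 0"
    proof
      assume "d' = 0"
      then have "g = (\<lambda>x. 0)" using bspec[OF unique \<open>g \<in> Z\<close>] by auto
      then show False using x0 by simp
    qed
    moreover have "\<not> 2 \<le> d'"
    proof
      assume "2 \<le> d'"
      \<comment> \<open>A nontrivial linear relation between the first two alleged basis elements,
        which contradicts uniqueness of the coefficients of 0.\<close>
      define u where "u = (if b 0 = 0 \<and> b 1 = 0 then (1, 0) else (b 1, - b 0))"
      define a where "a = (\<lambda>j\<in>{..<d'}. if j = 0 then fst u else if j = 1 then snd u else 0)"
      have "(\<Sum>j<d'. a j * b j) = (\<Sum>j\<in>{0, 1}. a j * b j)"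
        using \<open>2 \<le> d'\<close> by (intro sum.mono_neutral_right) (auto simp: a_def)
      also have "\<dots> = 0" using \<open>2 \<le> d'\<close> by (auto simp: a_def u_def)
      finally have "a = (\<lambda>j\<in>{..<d'}. 0)"
        by (intro zero) (auto simp: a_def)
      then have "a 0 = 0" "a 1 = 0" using \<open>2 \<le> d'\<close> by auto
      then show False using \<open>2 \<le> d'\<close> by (auto simp: a_def u_def split: if_splits)
    qed
    ultimately show "d' = 1" by linarith
  qed
  then show ?thesis by simp
qed

text \<open>The recurrence leaves the constant \<open>P_3\<close> free. The value 0, which would occur if the moduli
  space were empty, is harmless: all \<open>P_m\<close> with \<open>m \<ge> 3\<close> would then vanish.\<close>

lemma betti_3_0_le_1: "betti 3 0 \<le> 1"
proof -
  have "cocycles 0 (moduli_space 3) = {\<lambda>s. a * const_cochain (moduli_space 3) s |a. True}"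
    using cocycles_0_indiscrete[OF moduli_space_3_indiscrete] const_cochain_cocycle by blast
  then show ?thesis
    unfolding betti_def cohomology_dim_def coboundaries_def mult_0_right nat.case
    by (rule quotient_dim_line)
qed

section \<open>Ultra-log-concavity\<close>

lemma coeff_poincare_poly:
  assumes "n \<ge> 3" "i \<le> n - 3"
  shows "coeff (poincare_poly n) i = real (betti n i)"
  using assms by (simp add: poincare_poly_def coeff_sum)

lemma degree_poincare_poly: "degree (poincare_poly n) \<le> n - 3"
  by (auto simp: poincare_poly_def intro!: degree_sum_le order_trans[OF degree_monom_le])

lemma poincare_poly_3: "poincare_poly 3 = [:real (betti 3 0):]"
  by (simp add: poincare_poly_def monom_0)

text \<open>Every term of the recurrence has a factor with index at least 3 and below
  \<open>m\<close>, so the conventional value 1 at index 2 never enters.\<close>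

lemma poincare_poly_eq_0:
  assumes rec: "\<forall>m>3. poincare_poly m =
       [:1, 1:] * poincare_poly (m - 1) +
       [:0, 1:] * (\<Sum>j = 3..m - 2.
         of_nat ((m - 2) choose (j - 1)) * poincare_poly j * poincare_poly (m + 1 - j))"
    and "betti 3 0 = 0" "m \<ge> 3"
  shows "poincare_poly m = 0"
  using assms(3)
proof (induction m rule: less_induct)
  case (less m)
  show ?case
  proof (cases "m = 3")
    case True
    then show ?thesis using assms(2) by (simp add: poincare_poly_3)
  next
    case False
    then have m: "m > 3" using less.prems by simp
    have "poincare_poly (m - 1) = 0" using less.IH[of "m - 1"] m by simp
    moreover have "(\<Sum>j = 3..m - 2.
        of_nat ((m - 2) choose (j - 1)) * poincare_poly j * poincare_poly (m + 1 - j)) = 0"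
    proof (intro sum.neutral ballI)
      fix j assume "j \<in> {3..m - 2}"
      then have "j < m" "3 \<le> j" using m by auto
      then have "poincare_poly j = 0" by (rule less.IH)
      then show "of_nat ((m - 2) choose (j - 1)) * poincare_poly j * poincare_poly (m + 1 - j) = 0"
        by simp
    qed
    ultimately show ?thesis using rec[rule_format, OF m] by simp
  qed
qed

lemma poly_poincare_poly:
  assumes rec: "\<forall>m>3. poincare_poly m =
       [:1, 1:] * poincare_poly (m - 1) +
       [:0, 1:] * (\<Sum>j = 3..m - 2.
         of_nat ((m - 2) choose (j - 1)) * poincare_poly j * poincare_poly (m + 1 - j))"
    and "betti 3 0 = 1"
  shows "poly (poincare_poly (k + 3)) t = poly (keel_flow k t) 0"
proof (rule keel_recurrence_keel_flow)
  show "poly (poincare_poly 2) t = 1" by (simp add: poincare_poly_def)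
  show "poly (poincare_poly 3) t = 1" using assms(2) by (simp add: poincare_poly_3)
  fix m :: nat assume "m > 3"
  show "poly (poincare_poly m) t = (1 + t) * poly (poincare_poly (m - 1)) t + t *
      (\<Sum>j = 3..m - 2. real ((m - 2) choose (j - 1)) * poly (poincare_poly j) t
        * poly (poincare_poly (m + 1 - j)) t)"
    by (subst rec[rule_format, OF \<open>m > 3\<close>]) (simp add: poly_sum algebra_simps)
qed

theorem corollary1p3:
  fixes n i :: nat
  assumes keel_recurrence:
    "\<forall>m>3. poincare_poly m =
       [:1, 1:] * poincare_poly (m - 1) +
       [:0, 1:] * (\<Sum>j = 3..m - 2.
         of_nat ((m - 2) choose (j - 1)) * poincare_poly j * poincare_poly (m + 1 - j))"
    and "n \<ge> 3" and "1 \<le> i" and "i \<le> n - 4"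
  shows "(real (betti n i) / real ((n - 3) choose i))\<^sup>2 \<ge>
    real (betti n (i - 1)) / real ((n - 3) choose (i - 1)) *
    (real (betti n (i + 1)) / real ((n - 3) choose (i + 1)))"
proof (cases "betti 3 0 = 0")
  case True
  have "real (betti n i) = 0" "real (betti n (i - 1)) = 0"
    using poincare_poly_eq_0[OF keel_recurrence True \<open>n \<ge> 3\<close>] assms(2-4)
      coeff_poincare_poly[of n i] coeff_poincare_poly[of n "i - 1"] by simp_all
  then show ?thesis by simp
next
  case False
  then have b: "betti 3 0 = 1" using betti_3_0_le_1 by linarith
  have n: "n - 3 + 3 = n" using \<open>n \<ge> 3\<close> by simp
  have "neg_rooted (n - 3) (poincare_poly n)"
    using poly_poincare_poly[OF keel_recurrence b, of "n - 3"] degree_poincare_poly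
    unfolding n by (rule neg_rooted_keel_flow_at_0)
  \<comment> \<open>With truncated subtraction, \<open>1 <= i\<close> and \<open>i <= n - 4\<close>
    force \<open>n >= 5\<close>; hence \<open>i < n - 3\<close>, and \<open>i + 1\<close> is still
    within the degree.\<close>
  then have "ncoeff (n - 3) (poincare_poly n) (i - 1) * ncoeff (n - 3) (poincare_poly n) (i + 1)
      \<le> (ncoeff (n - 3) (poincare_poly n) i)\<^sup>2"
    using assms(3,4) by (intro Newton_inequality) auto
  moreover have "ncoeff (n - 3) (poincare_poly n) j = real (betti n j) / real ((n - 3) choose j)"
    if "j \<le> n - 3" for j
    using that \<open>n \<ge> 3\<close> by (simp add: ncoeff_def coeff_poincare_poly)
  ultimately show ?thesis using assms(3,4) by simp
qed

end
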